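(* Let $ABC$ be an isosceles triangle with base angles $\alpha$, where $\alpha$ is not a rational multiple of $\pi$. Suppose $ABC$ is $N$-tiled by a tile with angles $(\alpha,\beta,\gamma)$, $\gamma=2\alpha$, and integer sides $(a,b,c)$ with no common factor. Then the squarefree part of $N$ divides $b$ and the squarefree part of $b$ divides $N$. If $N$ is squarefree, then $N$ divides $b$, and $b/N$ is a square, i.e., $b=N\ell^2$ for some integer $\ell$.
   Context: An $N$-tiling of a triangle $ABC$ by a triangle $T$ (the tile) is a set of $N$ triangles congruent to $T$ (reflections allowed) whose interiors are pairwise disjoint and whose union is $ABC$ (tiles need not meet edge to edge). The sides $a,b,c$ of the tile are opposite its angles $\alpha,\beta,\gamma$ respectively. "Isosceles" means exactly two sides are equal. The squarefree part of a positive integer is the product of the primes dividing it to an odd power. *)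

theory Defs
  imports
    "HOL-Analysis.Analysis"
    "HOL-Computational_Algebra.Squarefree"
    "HOL-Computational_Algebra.Nth_Powers"
begin

type_synonym point = "real^2"

definition nondegenerate_triangle :: "point \<Rightarrow> point \<Rightarrow> point \<Rightarrow> bool" where
  "nondegenerate_triangle A B C \<longleftrightarrow> \<not> collinear {A, B, C}"

definition triangle_region :: "point \<Rightarrow> point \<Rightarrow> point \<Rightarrow> point set" where
  "triangle_region A B C = convex hull {A, B, C}"

(* the unoriented angle at the middle argument B, a number in [0, pi] *)
definition angle :: "point \<Rightarrow> point \<Rightarrow> point \<Rightarrow> real" where
  "angle A B C = arccos (((A - B) \<bullet> (C - B)) / (norm (A - B) * norm (C - B)))"

(* Exactly two sides are equal; the apex is the first argument, so the base is BC.
   Naming the apex loses no generality, since the vertices may be relabelled. *)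
definition isosceles_with_apex :: "point \<Rightarrow> point \<Rightarrow> point \<Rightarrow> bool" where
  "isosceles_with_apex A B C \<longleftrightarrow>
     nondegenerate_triangle A B C \<and> dist A B = dist A C \<and> dist B C \<noteq> dist A B"

definition has_base_angles :: "point \<Rightarrow> point \<Rightarrow> point \<Rightarrow> real \<Rightarrow> bool" where
  "has_base_angles A B C \<theta> \<longleftrightarrow> angle A B C = \<theta> \<and> angle A C B = \<theta>"

definition has_angles :: "point \<Rightarrow> point \<Rightarrow> point \<Rightarrow> real \<Rightarrow> real \<Rightarrow> real \<Rightarrow> bool" where
  "has_angles P Q R \<alpha> \<beta> \<gamma> \<longleftrightarrow> angle Q P R = \<alpha> \<and> angle P Q R = \<beta> \<and> angle P R Q = \<gamma>"

(* side lengths listed in the order of the vertices they are opposite to *)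
definition has_sides :: "point \<Rightarrow> point \<Rightarrow> point \<Rightarrow> real \<Rightarrow> real \<Rightarrow> real \<Rightarrow> bool" where
  "has_sides P Q R a b c \<longleftrightarrow> dist Q R = a \<and> dist P R = b \<and> dist P Q = c"

(* The isometry need not preserve orientation, so reflected copies are included. *)
definition congruent_regions :: "point set \<Rightarrow> point set \<Rightarrow> bool" where
  "congruent_regions S T \<longleftrightarrow>
     (\<exists>f :: point \<Rightarrow> point. (\<forall>x y. dist (f x) (f y) = dist x y) \<and> S = f ` T)"

definition is_tiling :: "point set set \<Rightarrow> nat \<Rightarrow> point set \<Rightarrow> point set \<Rightarrow> bool" where
  "is_tiling \<T> N X T \<longleftrightarrow>
     finite \<T> \<and> card \<T> = N \<and>
     (\<forall>S\<in>\<T>. congruent_regions S T) \<and>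
     pairwise (\<lambda>S S'. interior S \<inter> interior S' = {}) \<T> \<and>
     \<Union>\<T> = X"

definition tiled_by :: "nat \<Rightarrow> point set \<Rightarrow> point set \<Rightarrow> bool" where
  "tiled_by N X T \<longleftrightarrow> (\<exists>\<T>. is_tiling \<T> N X T)"

(* The library defines squarefree_part n as the cofactor of the largest square dividing n;
   for positive n it is the product of the primes dividing n to an odd power. *)
lemma squarefree_part_eq_prod_odd_primes:
  fixes n :: nat
  assumes "n > 0"
  shows "squarefree_part n = \<Prod>{p \<in> prime_factors n. odd (multiplicity p n)}"
proof -
  let ?P = "prime_factors n"
  have "n = (\<Prod>p\<in>?P. p ^ multiplicity p n)"
    using assms by (simp add: prime_factorization_nat)
  also have "\<dots> = (\<Prod>p\<in>?P. (p ^ (multiplicity p n div 2))\<^sup>2 * p ^ (multiplicity p n mod 2))"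
    by (intro prod.cong refl) (metis mult.commute div_mult_mod_eq power_add power_mult)
  also have "\<dots> = (square_part n)\<^sup>2 * (\<Prod>p\<in>?P. p ^ (multiplicity p n mod 2))"
    using assms by (simp add: prod.distrib square_part_nonzero prod_power_distrib)
  also have "(\<Prod>p\<in>?P. p ^ (multiplicity p n mod 2))
      = (\<Prod>p\<in>?P. if odd (multiplicity p n) then p else 1)"
    by (intro prod.cong refl) (simp add: odd_iff_mod_2_eq_one)
  also have "\<dots> = \<Prod>{p \<in> ?P. odd (multiplicity p n)}"
    by (simp add: prod.inter_filter)
  finally have "n div (square_part n)\<^sup>2 = \<Prod>{p \<in> ?P. odd (multiplicity p n)}"
    by (metis assms nonzero_mult_div_cancel_left power_eq_0_iff square_part_0_iff less_numeral_extra(3))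
  then show ?thesis
    using assms by (simp add: squarefree_part_def)
qed

end

theory Submission
  imports Defs
begin

text \<open>
  The claim reduces to the assertion that \<open>N * b\<close> is a perfect square: then every prime has
  multiplicities of equal parity in \<open>N\<close> and \<open>b\<close>, so the two numbers have the same squarefree
  part, and all the stated divisibilities are read off from that.

  Let \<open>X\<close> be the length of the two equal sides of \<open>ABC\<close>. Since the base angle is \<open>\<alpha>\<close>, the area of
  \<open>ABC\<close> is \<open>X\<^sup>2 cos \<alpha> sin \<alpha>\<close>, and the area of the tile is \<open>b c sin \<alpha> / 2\<close>. In the tile
  \<open>\<gamma> = 2\<alpha>\<close> gives \<open>c = 2 a cos \<alpha>\<close> by the law of sines and then \<open>c\<^sup>2 = a (a + b)\<close> by the law of
  cosines (\<open>double_angle_triangle_sides\<close>). Comparing areas (\<open>tiled_area\<close>) yields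
  \<open>X\<^sup>2 = N a b\<close>. Because \<open>a\<close>, \<open>b\<close>, \<open>c\<close> have no common factor, \<open>a\<close> and \<open>a + b\<close> are coprime with
  product a square, so \<open>a\<close> is itself a square (\<open>square_if_mult_add_square\<close>). Hence \<open>N * b\<close> is a
  square as soon as \<open>X\<close> is an integer.

  That \<open>X\<close> is an integer is the geometric input (\<open>tiled_side_Nats\<close>): a side of a tiled triangle
  is a union of sides of tiles that overlap only in endpoints. This is made precise by cutting
  the tiling with the line through the side and taking one-dimensional Lebesgue measure. As all
  tiles lie on one side of that line, each meets it in nothing, a vertex, or a whole edge, so its
  cut has length \<open>0\<close>, \<open>a\<close>, \<open>b\<close> or \<open>c\<close> (\<open>measure_trace_triangle\<close>). Two distinct tiles cannot share
  a segment of the line, since next to an inner point of that segment both would contain the same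
  points of the half-plane in their interiors (\<open>negligible_trace_Int\<close>). So the length of the side
  is a finite sum of integers.
\<close>

section \<open>Area and angles of a triangle\<close>

lemma noncollinear_distinct:
  "\<not> collinear {P, Q, R} \<Longrightarrow> P \<noteq> Q \<and> P \<noteq> R \<and> Q \<noteq> R"
  by (auto simp: insert_commute)

lemma cos_angle:
  "dist A B * dist C B * cos (angle A B C) = (A - B) \<bullet> (C - B)"
proof -
  have "\<bar>((A - B) \<bullet> (C - B)) / (norm (A - B) * norm (C - B))\<bar> \<le> 1"
    using Cauchy_Schwarz_ineq2[of "A - B" "C - B"]
    by (cases "norm (A - B) * norm (C - B) = 0") (auto simp: divide_simps abs_mult)
  then show ?thesis
    by (cases "norm (A - B) * norm (C - B) = 0") (auto simp: angle_def dist_norm cos_arccos_abs)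
qed

lemma sin_angle_nonneg: "sin (angle A B C) \<ge> 0"
proof -
  have "\<bar>((A - B) \<bullet> (C - B)) / (norm (A - B) * norm (C - B))\<bar> \<le> 1"
    using Cauchy_Schwarz_ineq2[of "A - B" "C - B"]
    by (cases "norm (A - B) * norm (C - B) = 0") (auto simp: divide_simps abs_mult)
  then show ?thesis
    unfolding angle_def by (intro sin_ge_zero arccos_lbound arccos_ubound) linarith+
qed

lemma law_of_cosines:
  "(dist A C)\<^sup>2 = (dist A B)\<^sup>2 + (dist C B)\<^sup>2 - 2 * dist A B * dist C B * cos (angle A B C)"
proof -
  have "(dist A C)\<^sup>2 = (norm ((A - B) - (C - B)))\<^sup>2"
    by (simp add: dist_norm)
  also have "\<dots> = (dist A B)\<^sup>2 + (dist C B)\<^sup>2 - 2 * ((A - B) \<bullet> (C - B))"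
    by (simp only: dist_norm power2_norm_eq_inner inner_diff_left inner_diff_right inner_commute)
      (simp add: inner_commute)
  finally show ?thesis
    by (simp add: cos_angle[symmetric])
qed

lemma measure_lebesgue_hull_3:
  fixes A B C :: point
  shows "measure lebesgue (convex hull {A, B, C}) = measure lborel (convex hull {A, B, C})"
  by (simp add: borel_compact finite_imp_compact_convex_hull)

text \<open>The determinant in the coordinate formula for the area and the inner product are tied
  together by the Lagrange identity, which turns the area into a sine.\<close>

lemma area_triangle_sin:
  "measure lebesgue (convex hull {A, B, C}) = dist A B * dist C B * sin (angle A B C) / 2"
proof -
  let ?d = "(A$1 - B$1) * (C$2 - B$2) - (A$2 - B$2) * (C$1 - B$1)"
  have "measure lebesgue (convex hull {A, B, C}) = \<bar>?d\<bar> / 2"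
    by (simp add: measure_lebesgue_hull_3 content_triangle add: algebra_simps abs_minus_commute)
  moreover have "\<bar>?d\<bar> = dist A B * dist C B * sin (angle A B C)"
  proof (rule power2_eq_imp_eq)
    have lagrange: "(x1 * y2 - x2 * y1)\<^sup>2 = (x1\<^sup>2 + x2\<^sup>2) * (y1\<^sup>2 + y2\<^sup>2) - (x1 * y1 + x2 * y2)\<^sup>2"
      for x1 x2 y1 y2 :: real
      by algebra
    have "?d\<^sup>2 = (dist A B)\<^sup>2 * (dist C B)\<^sup>2 - ((A - B) \<bullet> (C - B))\<^sup>2"
      unfolding lagrange
      by (simp only: dist_norm power2_norm_eq_inner inner_vec_def sum_2) (simp add: power2_eq_square)
    also have "\<dots> = (dist A B)\<^sup>2 * (dist C B)\<^sup>2 * (1 - (cos (angle A B C))\<^sup>2)"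
      unfolding cos_angle[symmetric] by (simp add: power_mult_distrib algebra_simps)
    finally show "\<bar>?d\<bar>\<^sup>2 = (dist A B * dist C B * sin (angle A B C))\<^sup>2"
      by (simp add: sin_squared_eq power_mult_distrib)
  qed (auto simp: sin_angle_nonneg)
  ultimately show ?thesis by simp
qed

lemma sin_angle_pos:
  assumes "\<not> collinear {A, B, C}"
  shows "sin (angle A B C) > 0"
proof (rule ccontr)
  assume "\<not> ?thesis"
  then have "sin (angle A B C) = 0"
    using sin_angle_nonneg[of A B C] by simp
  then have "\<bar>cos (angle A B C)\<bar> = 1"
    using sin_zero_abs_cos_one by blast
  then have "\<bar>(A - B) \<bullet> (C - B)\<bar> = norm (A - B) * norm (C - B)"
    unfolding cos_angle[symmetric] abs_mult by (simp add: dist_norm)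
  then have "collinear {0, A - B, C - B}"
    using norm_cauchy_schwarz_equal by blast
  then have "collinear {A, B, C}"
    by (subst collinear_3) auto
  with assms show False ..
qed

section \<open>Lengths of tile edges along a side\<close>

text \<open>In this section a line is given by a point \<open>A\<close>, a direction \<open>u\<close> and a normal \<open>n\<close>; the sign of
  \<open>n \<bullet> x - n \<bullet> A\<close> tells on which side of the line \<open>x\<close> lies. That vectors orthogonal to \<open>n\<close> are
  all parallel is where the dimension of the plane enters.\<close>

lemma orthogonal_to_same_parallel:
  fixes w e n :: "real^2"
  assumes "n \<noteq> 0" "e \<noteq> 0" "w \<bullet> n = 0" "e \<bullet> n = 0"
  obtains m where "w = m *\<^sub>R e"
proof
  have n: "n$1 \<noteq> 0 \<or> n$2 \<noteq> 0" and e: "(e$1)\<^sup>2 + (e$2)\<^sup>2 \<noteq> 0"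
    using assms by (auto simp: vec_eq_iff forall_2)
  have 1: "w$1 * n$1 + w$2 * n$2 = 0" "e$1 * n$1 + e$2 * n$2 = 0"
    using assms by (auto simp: inner_vec_def sum_2)
  have "(w$1 * e$2 - w$2 * e$1) * n$1 = 0" "(w$1 * e$2 - w$2 * e$1) * n$2 = 0"
    using 1 by algebra+
  with n have "w$1 * e$2 = w$2 * e$1" by auto
  then have "w$1 * ((e$1)\<^sup>2 + (e$2)\<^sup>2) = (w$1 * e$1 + w$2 * e$2) * e$1"
    "w$2 * ((e$1)\<^sup>2 + (e$2)\<^sup>2) = (w$1 * e$1 + w$2 * e$2) * e$2" 
    by algebra+
  then show "w = ((w$1 * e$1 + w$2 * e$2) / ((e$1)\<^sup>2 + (e$2)\<^sup>2)) *\<^sub>R e"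
    using e by (simp add: vec_eq_iff forall_2 field_simps)
qed

lemma not_collinear_height:
  fixes p q r n :: "'a::euclidean_space"
  assumes "p \<noteq> q" "n \<bullet> p = d" "n \<bullet> q = d" "n \<bullet> r \<noteq> d"
  shows "\<not> collinear {p, q, r}"
proof
  assume "collinear {p, q, r}"
  then have "r \<in> affine hull {p, q}"
    using collinear_3_affine_hull assms(1) by blast
  then obtain s t where "r = s *\<^sub>R p + t *\<^sub>R q" "s + t = 1"
    by (auto simp: affine_hull_2)
  then have "n \<bullet> r = d"
    using assms by (simp add: inner_add_right flip: distrib_right)
  with assms show False by simp
qed

lemma collinear_level_line:
  fixes p q r n :: "real^2"
  assumes "n \<noteq> 0" "n \<bullet> p = d" "n \<bullet> q = d" "n \<bullet> r = d"
  shows "collinear {p, q, r}"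
proof (cases "p = q")
  case False
  have "(q - p) \<bullet> n = 0" "(r - p) \<bullet> n = 0"
    using assms by (auto simp: inner_diff_right inner_commute[of _ n])
  moreover have "q - p \<noteq> 0" using False by simp
  ultimately obtain m where "r - p = m *\<^sub>R (q - p)"
    using orthogonal_to_same_parallel assms(1) by metis
  then have "collinear {0, q - p, r - p}"
    unfolding collinear_lemma by blast
  then have "collinear {q, p, r}"
    by (subst collinear_3) auto
  then show ?thesis by (simp add: insert_commute)
qed auto

text \<open>The midpoint of an edge of a triangle becomes an interior point when it is pushed slightly
  towards the side of the third vertex, whatever the direction \<open>v\<close> of the push. That \<open>v\<close> may be
  chosen independently of the triangle is what allows two tiles along a common line to be compared.\<close>

lemma eventually_interior_convex:
  fixes S :: "(real^2) set"
  assumes "convex S" "p \<in> S" "q \<in> S" "r \<in> S" "p \<noteq> q"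
    and h: "n \<bullet> p = d" "n \<bullet> q = d" "n \<bullet> r > d" and v: "n \<bullet> v > 0"
  shows "\<forall>\<^sub>F \<epsilon> in at_right (0::real). midpoint p q + \<epsilon> *\<^sub>R v \<in> interior S"
proof -
  let ?z = "midpoint p q"
  (* v is expanded in the basis r - ?z, q - p: comparing heights over the line forces the
     coefficient k of r - ?z, and the rest is parallel to the line. *)
  define k where "k = (n \<bullet> v) / (n \<bullet> r - d)"
  have nz: "n \<bullet> ?z = d"
    using h(1,2) by (simp add: midpoint_def inner_add_right)
  have "n \<bullet> (v - k *\<^sub>R (r - ?z)) = n \<bullet> v - k * (n \<bullet> r - d)"
    by (simp add: inner_diff_right nz)
  also have "\<dots> = 0"
    using h by (simp add: k_def)
  finally have "(v - k *\<^sub>R (r - ?z)) \<bullet> n = 0"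
    by (simp only: inner_commute)
  moreover have "(q - p) \<bullet> n = 0"
    using h by (simp add: inner_diff_right inner_commute[of _ n])
  moreover have "n \<noteq> 0" "q - p \<noteq> 0"
    using v \<open>p \<noteq> q\<close> by auto
  ultimately obtain m where m: "v - k *\<^sub>R (r - ?z) = m *\<^sub>R (q - p)"
    using orthogonal_to_same_parallel by metis
  then have v_eq: "v = k *\<^sub>R (r - ?z) + m *\<^sub>R (q - p)"
    by (simp add: algebra_simps)
  have hull: "interior (convex hull {p, q, r}) \<subseteq> interior S"
    by (intro interior_mono hull_minimal) (use assms in auto)
  have nc: "\<not> collinear {p, q, r}"
    using not_collinear_height[of p q n d r] \<open>p \<noteq> q\<close> h by simp
  have bary: "?z + \<epsilon> *\<^sub>R v = ((1 - \<epsilon> * k) / 2 - \<epsilon> * m) *\<^sub>R p + ((1 - \<epsilon> * k) / 2 + \<epsilon> * m) *\<^sub>R q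
      + (\<epsilon> * k) *\<^sub>R r" for \<epsilon>
    by (subst v_eq) (simp add: midpoint_def vec_eq_iff field_simps)
  (* At \<epsilon> = 0 the barycentric coordinates of p and q are 1/2, so they stay positive nearby,
     while that of r is positive as soon as \<epsilon> is. *)
  have lim: "((\<lambda>\<epsilon>. (1 - \<epsilon> * k) / 2 - \<epsilon> * m) \<longlongrightarrow> (1 - 0 * k) / 2 - 0 * m) (at_right 0)"
    "((\<lambda>\<epsilon>. (1 - \<epsilon> * k) / 2 + \<epsilon> * m) \<longlongrightarrow> (1 - 0 * k) / 2 + 0 * m) (at_right 0)"
    by (intro tendsto_intros; simp)+
  have "k > 0" using h v by (simp add: k_def)
  have "\<forall>\<^sub>F \<epsilon> in at_right 0. (1 - \<epsilon> * k) / 2 - \<epsilon> * m > 0"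
    "\<forall>\<^sub>F \<epsilon> in at_right 0. (1 - \<epsilon> * k) / 2 + \<epsilon> * m > 0"
    using order_tendstoD(1)[OF lim(1), of 0] order_tendstoD(1)[OF lim(2), of 0] by simp_all
  moreover have "\<forall>\<^sub>F \<epsilon> in at_right (0::real). \<epsilon> > 0"
    by (rule eventually_at_right_less)
  ultimately show ?thesis
  proof eventually_elim
    case (elim \<epsilon>)
    moreover have "\<epsilon> * k > 0"
      using elim \<open>k > 0\<close> by simp
    moreover have "(1 - \<epsilon> * k) / 2 - \<epsilon> * m + ((1 - \<epsilon> * k) / 2 + \<epsilon> * m) + \<epsilon> * k = 1"
      by (simp add: field_simps)
    ultimately have "?z + \<epsilon> *\<^sub>R v \<in> interior (convex hull {p, q, r})"
      unfolding interior_convex_hull_3_minimal[OF nc, simplified] bary by blast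
    with hull show ?case by blast
  qed
qed

text \<open>The cut of \<open>S\<close> by a line, pulled back to the parameter \<open>t\<close>, so that for a unit vector \<open>u\<close> the
  length of the cut is a Lebesgue measure on the reals.\<close>

definition trace :: "point \<Rightarrow> point \<Rightarrow> point set \<Rightarrow> real set" where
  "trace A u S = {t. A + t *\<^sub>R u \<in> S}"

lemma convex_trace: "convex S \<Longrightarrow> convex (trace A u S)"
  unfolding convex_def trace_def
proof (clarsimp)
  fix x y s t :: real
  assume *: "\<forall>x\<in>S. \<forall>y\<in>S. \<forall>u\<ge>0. \<forall>v\<ge>0. u + v = 1 \<longrightarrow> u *\<^sub>R x + v *\<^sub>R y \<in> S"
    "A + x *\<^sub>R u \<in> S" "A + y *\<^sub>R u \<in> S" "0 \<le> s" "0 \<le> t" "s + t = 1"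
  then have "s *\<^sub>R (A + x *\<^sub>R u) + t *\<^sub>R (A + y *\<^sub>R u) \<in> S" by blast
  moreover have "s *\<^sub>R (A + x *\<^sub>R u) + t *\<^sub>R (A + y *\<^sub>R u) = (s + t) *\<^sub>R A + (s * x + t * y) *\<^sub>R u"
    by (simp add: algebra_simps)
  ultimately show "A + (s * x + t * y) *\<^sub>R u \<in> S" using * by simp
qed

text \<open>If the cuts shared an open interval, both sets would contain a common segment of the line;
  pushing its midpoint along the normal leads into both interiors at once.\<close>

lemma negligible_trace_Int:
  assumes "convex S" "convex S'" "interior S \<inter> interior S' = {}" "u \<noteq> 0" "n \<bullet> u = 0"
    and "r \<in> S" "n \<bullet> r > n \<bullet> A" "r' \<in> S'" "n \<bullet> r' > n \<bullet> A"
  shows "negligible (trace A u S \<inter> trace A u S')"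
proof -
  have False if "t \<in> interior (trace A u S \<inter> trace A u S')" for t
  proof -
    from that obtain e where e: "e > 0" "cball t e \<subseteq> trace A u S \<inter> trace A u S'"
      by (meson mem_interior_cball)
    define p q where "p = A + (t - e) *\<^sub>R u" and "q = A + (t + e) *\<^sub>R u"
    have "t - e \<in> cball t e" "t + e \<in> cball t e"
      using e(1) by (auto simp: dist_norm)
    then have "t - e \<in> trace A u S \<inter> trace A u S'" "t + e \<in> trace A u S \<inter> trace A u S'"
      using e(2) by blast+
    then have S: "p \<in> S" "p \<in> S'" "q \<in> S" "q \<in> S'"
      by (auto simp: trace_def p_def q_def)
    have pq: "p \<noteq> q" "n \<bullet> p = n \<bullet> A" "n \<bullet> q = n \<bullet> A"
      using assms e(1) by (auto simp: p_def q_def inner_add_right)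
    have v: "n \<bullet> n > 0" using assms by force
    have "\<forall>\<^sub>F \<epsilon> in at_right (0::real). midpoint p q + \<epsilon> *\<^sub>R n \<in> interior S"
      "\<forall>\<^sub>F \<epsilon> in at_right (0::real). midpoint p q + \<epsilon> *\<^sub>R n \<in> interior S'"
      using eventually_interior_convex[OF assms(1) S(1,3) assms(6) pq assms(7) v]
        eventually_interior_convex[OF assms(2) S(2,4) assms(8) pq assms(9) v] by auto
    then have "\<forall>\<^sub>F \<epsilon> in at_right (0::real). False"
      by eventually_elim (use assms(3) in blast)
    then show False by simp
  qed
  then have "interior (trace A u S \<inter> trace A u S') = {}" by blast
  moreover have "convex (trace A u S \<inter> trace A u S')"
    by (intro convex_Int convex_trace assms(1,2))
  ultimately show ?thesis
    using negligible_convex_interior by blast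
qed

text \<open>A convex combination of points on or above a line lies on the line only if the points
  strictly above it get weight zero. So a triangle resting on the line touches it in the hull of
  those of its vertices that lie on the line.\<close>

lemma convex_hull_3_level_vertex:
  fixes n :: "real^2"
  assumes "n \<bullet> q > d" "n \<bullet> r > d" "n \<bullet> p \<ge> d" "x \<in> convex hull {p, q, r}" "n \<bullet> x = d"
  shows "x = p"
proof -
  obtain u v w where uvw: "0 \<le> u" "0 \<le> v" "0 \<le> w" "u + v + w = 1" "x = u *\<^sub>R p + v *\<^sub>R q + w *\<^sub>R r"
    using assms(4) unfolding convex_hull_3 by blast
  have "u * (n \<bullet> p - d) + v * (n \<bullet> q - d) + w * (n \<bullet> r - d) = n \<bullet> x - (u + v + w) * d"
    unfolding uvw(5) by (simp add: inner_add_right algebra_simps)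
  also have "\<dots> = 0" using assms(5) uvw(4) by simp
  finally have "u * (n \<bullet> p - d) + v * (n \<bullet> q - d) + w * (n \<bullet> r - d) = 0" .
  moreover have "u * (n \<bullet> p - d) \<ge> 0" "v * (n \<bullet> q - d) \<ge> 0" "w * (n \<bullet> r - d) \<ge> 0"
    using assms uvw by auto
  ultimately have "v * (n \<bullet> q - d) = 0" "w * (n \<bullet> r - d) = 0" by linarith+
  then have "v = 0" "w = 0" using assms by auto
  with uvw show ?thesis by simp
qed

lemma convex_hull_3_level_edge:
  fixes n :: "real^2"
  assumes "n \<bullet> r > d" "n \<bullet> p = d" "n \<bullet> q = d" 
  shows "x \<in> convex hull {p, q, r} \<and> n \<bullet> x = d \<longleftrightarrow> x \<in> closed_segment p q"
proof (intro iffI conjI)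
  assume *: "x \<in> convex hull {p, q, r} \<and> n \<bullet> x = d"
  then have nx: "n \<bullet> x = d" by blast
  from * obtain u v w where uvw: "0 \<le> u" "0 \<le> v" "0 \<le> w" "u + v + w = 1" "x = u *\<^sub>R p + v *\<^sub>R q + w *\<^sub>R r"
    unfolding convex_hull_3 by blast
  have "w * (n \<bullet> r - d) = n \<bullet> x - (u + v + w) * d"
    unfolding uvw(5) using assms by (simp add: inner_add_right algebra_simps)
  then have "w = 0" using nx uvw(4) assms by simp
  with uvw show "x \<in> closed_segment p q"
    unfolding closed_segment_def by (intro CollectI exI[of _ v]) auto
next
  assume x: "x \<in> closed_segment p q"
  then show "x \<in> convex hull {p, q, r}"
    unfolding segment_convex_hull using hull_mono[of "{p, q}" "{p, q, r}" convex] by blast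
  from x obtain s where "x = (1 - s) *\<^sub>R p + s *\<^sub>R q"
    unfolding in_segment by blast
  then have "n \<bullet> x = (1 - s) * d + s * d"
    using assms(2,3) by (simp add: inner_add_right)
  then show "n \<bullet> x = d"
    by (simp add: algebra_simps)
qed

lemma measure_trace_vertex:
  assumes "u \<noteq> 0" "n \<bullet> u = 0" "n \<bullet> q > n \<bullet> A" "n \<bullet> r > n \<bullet> A" "n \<bullet> p \<ge> n \<bullet> A"
  shows "measure lebesgue (trace A u (convex hull {p, q, r})) = 0"
proof -
  have *: "A + t *\<^sub>R u = p" if "t \<in> trace A u (convex hull {p, q, r})" for t
    using that assms convex_hull_3_level_vertex[of "n \<bullet> A" n q r p "A + t *\<^sub>R u"]
    by (auto simp: trace_def inner_add_right)
  have "s = t" if "s \<in> trace A u (convex hull {p, q, r})" "t \<in> trace A u (convex hull {p, q, r})" for s t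
    using *[OF that(1)] *[OF that(2)] assms(1) by (metis add_left_cancel scaleR_right_imp_eq)
  then have "trace A u (convex hull {p, q, r}) \<subseteq> {THE s. s \<in> trace A u (convex hull {p, q, r})}"
    by (auto intro: the_equality[symmetric])
  then have "negligible (trace A u (convex hull {p, q, r}))"
    using negligible_subset negligible_sing by blast
  then show ?thesis
    by (simp add: negligible_imp_measure0)
qed

lemma measure_trace_edge:
  assumes "norm u = 1" "n \<noteq> 0" "n \<bullet> u = 0" "n \<bullet> r > n \<bullet> A" "n \<bullet> p = n \<bullet> A" "n \<bullet> q = n \<bullet> A"
  shows "measure lebesgue (trace A u (convex hull {p, q, r})) = dist p q"
proof -
  let ?f = "\<lambda>t. A + t *\<^sub>R u"
  have u: "u \<noteq> 0" using assms(1) by auto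
  have inj: "inj ?f" using u by (auto simp: inj_on_def)
  have on_line: "\<exists>s. x = ?f s" if "n \<bullet> x = n \<bullet> A" for x
  proof -
    have "(x - A) \<bullet> n = 0" "u \<bullet> n = 0"
      using that assms(3) by (auto simp: inner_diff_right inner_commute[of _ n])
    then obtain s where "x - A = s *\<^sub>R u"
      using orthogonal_to_same_parallel u assms(2) by metis
    then show ?thesis by (auto simp: algebra_simps intro: exI[of _ s])
  qed
  obtain s s' where s: "p = ?f s" "q = ?f s'"
    using on_line assms(5,6) by metis
  have seg: "?f ` closed_segment s s' = closed_segment p q"
  proof -
    have "?f ` closed_segment s s' = (+) A ` ((\<lambda>t. t *\<^sub>R u) ` closed_segment s s')"
      by (auto simp: image_image)
    also have "\<dots> = closed_segment p q"
      by (simp add: s closed_segment_translation closed_segment_linear_image[of "\<lambda>t. t *\<^sub>R u"])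
    finally show ?thesis .
  qed
  have "n \<bullet> ?f t = n \<bullet> A" for t
    by (simp add: inner_add_right assms(3))
  then have "trace A u (convex hull {p, q, r}) = {t. ?f t \<in> closed_segment p q}"
    unfolding trace_def by (simp flip: convex_hull_3_level_edge[OF assms(4-6)])
  also have "\<dots> = closed_segment s s'"
    unfolding seg[symmetric] inj_image_mem_iff[OF inj] by simp
  finally have tr: "trace A u (convex hull {p, q, r}) = closed_segment s s'" .
  have "measure lebesgue (closed_segment s s') = \<bar>s - s'\<bar>"
    by (simp add: closed_segment_eq_real_ivl)
  also have "\<dots> = dist p q"
    using assms(1) by (simp add: s dist_norm flip: scaleR_diff_left)
  finally show ?thesis by (simp add: tr)
qed

lemma measure_trace_triangle:
  assumes "norm u = 1" "n \<noteq> 0" "n \<bullet> u = 0" "\<not> collinear {p, q, r}"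
    and "n \<bullet> p \<ge> n \<bullet> A" "n \<bullet> q \<ge> n \<bullet> A" "n \<bullet> r \<ge> n \<bullet> A"
  shows "measure lebesgue (trace A u (convex hull {p, q, r})) \<in> {0, dist q r, dist p r, dist p q}"
proof -
  have u: "u \<noteq> 0" using assms(1) by auto
  have perm: "{q, p, r} = {p, q, r}" "{r, p, q} = {p, q, r}" "{p, r, q} = {p, q, r}"
    "{q, r, p} = {p, q, r}" by auto
  note E = measure_trace_edge[OF assms(1-3)] and V = measure_trace_vertex[OF u assms(3)]
  have "\<not> (n \<bullet> p = n \<bullet> A \<and> n \<bullet> q = n \<bullet> A \<and> n \<bullet> r = n \<bullet> A)"
    using collinear_level_line[OF assms(2)] assms(4) by blast
  then consider "n \<bullet> q > n \<bullet> A" "n \<bullet> r > n \<bullet> A" | "n \<bullet> p > n \<bullet> A" "n \<bullet> r > n \<bullet> A"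
    | "n \<bullet> p > n \<bullet> A" "n \<bullet> q > n \<bullet> A"
    | "n \<bullet> p = n \<bullet> A" "n \<bullet> q = n \<bullet> A" "n \<bullet> r > n \<bullet> A"
    | "n \<bullet> p = n \<bullet> A" "n \<bullet> r = n \<bullet> A" "n \<bullet> q > n \<bullet> A"
    | "n \<bullet> q = n \<bullet> A" "n \<bullet> r = n \<bullet> A" "n \<bullet> p > n \<bullet> A"
    using assms(5-7) by linarith
  then show ?thesis
  proof cases
    case 1 with V[of A q r p] assms show ?thesis by simp
  next
    case 2 with V[of A p r q] assms show ?thesis by (simp add: perm)
  next
    case 3 with V[of A p q r] assms show ?thesis by (simp add: perm)
  next
    case 4 with E[of A r p q] show ?thesis by simp
  next
    case 5 with E[of A q p r] show ?thesis by (simp add: perm)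
  next
    case 6 with E[of A p q r] show ?thesis by (simp add: perm)
  qed
qed

lemma lmeasurable_trace_triangle:
  assumes "u \<noteq> 0" 
  shows "trace A u (convex hull {p, q, r}) \<in> lmeasurable"
proof -
  let ?f = "\<lambda>t. A + t *\<^sub>R u"
  have comp: "compact (convex hull {p, q, r})"
    by (simp add: finite_imp_compact_convex_hull)
  have eq: "trace A u (convex hull {p, q, r}) = ?f -` (convex hull {p, q, r})"
    by (auto simp: trace_def)
  have "closed (trace A u (convex hull {p, q, r}))"
    unfolding eq by (intro closed_vimage compact_imp_closed comp continuous_intros)
  moreover have "bounded (trace A u (convex hull {p, q, r}))"
  proof -
    obtain M where M: "\<And>x. x \<in> convex hull {p, q, r} \<Longrightarrow> norm x \<le> M"
      using compact_imp_bounded[OF comp] bounded_iff by blast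
    have "norm t \<le> (M + norm A) / norm u" if "t \<in> trace A u (convex hull {p, q, r})" for t
    proof -
      have "norm (t *\<^sub>R u) \<le> norm (?f t) + norm A"
        using norm_triangle_ineq4[of "?f t" A] by simp
      then show ?thesis
        using M[of "?f t"] that assms by (simp add: trace_def pos_le_divide_eq)
    qed
    then show ?thesis by (auto simp: bounded_iff)
  qed
  ultimately show ?thesis
    by (simp add: compact_eq_bounded_closed lmeasurable_compact)
qed

section \<open>Tilings by a triangle\<close>

text \<open>An isometry is a linear map followed by a translation, so it carries the hull of the vertices
  to the hull of their images.\<close>

lemma congruent_region_triangle:
  assumes "congruent_regions S (triangle_region P Q R)"
  obtains p q r where "S = convex hull {p, q, r}" 
    "dist q r = dist Q R" "dist p r = dist P R" "dist p q = dist P Q"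
proof -
  obtain f where f: "\<forall>x y. dist (f x) (f y) = dist x y" and S: "S = f ` (convex hull {P, Q, R})"
    using assms by (auto simp: congruent_regions_def triangle_region_def)
  define g where "g = (\<lambda>x. f x - f 0)"
  have "linear g"
    using isometry_linear[of g] f by (simp add: g_def dist_norm)
  have fg: "f = (\<lambda>x. f 0 + g x)" by (auto simp: g_def)
  have "S = (+) (f 0) ` (g ` (convex hull {P, Q, R}))"
    unfolding S by (subst fg) (simp add: image_image)
  also have "\<dots> = convex hull ((+) (f 0) ` g ` {P, Q, R})"
    using \<open>linear g\<close> by (simp only: convex_hull_linear_image convex_hull_translation)
  also have "(+) (f 0) ` g ` {P, Q, R} = {f P, f Q, f R}"
    by (simp add: g_def)
  finally show ?thesis
    using that f by auto
qed

lemma congruent_triangle_area: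
  fixes p q r P Q R :: point
  assumes "dist q r = dist Q R" "dist p r = dist P R" "dist p q = dist P Q"
  shows "measure lebesgue (convex hull {p, q, r}) = measure lebesgue (convex hull {P, Q, R})"
  by (simp only: measure_lebesgue_hull_3 heron assms)

text \<open>Since the area is determined by the side lengths, this transfers nondegeneracy from the tile
  to its congruent copies.\<close>

lemma collinear_iff_area_eq_0:
  fixes P Q R :: point
  shows "collinear {P, Q, R} \<longleftrightarrow> measure lebesgue (convex hull {P, Q, R}) = 0"
proof
  assume "collinear {P, Q, R}"
  then have "aff_dim (convex hull {P, Q, R}) < 2"
    by (simp add: collinear_aff_dim aff_dim_convex_hull)
  then have "interior (convex hull {P, Q, R}) = {}"
    using aff_dim_nonempty_interior[of "convex hull {P, Q, R}"] by auto
  then show "measure lebesgue (convex hull {P, Q, R}) = 0"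
    by (simp add: negligible_convex_interior negligible_imp_measure0)
next
  assume *: "measure lebesgue (convex hull {P, Q, R}) = 0"
  show "collinear {P, Q, R}"
  proof (rule ccontr)
    assume nc: "\<not> collinear {P, Q, R}"
    then have "P \<noteq> Q" "R \<noteq> Q" by auto
    with * sin_angle_pos[OF nc] show False
      by (simp add: area_triangle_sin)
  qed
qed

lemma tiled_area:
  fixes P Q R :: point
  assumes "tiled_by N X (triangle_region P Q R)"
  shows "measure lebesgue X = N * measure lebesgue (triangle_region P Q R)"
proof -
  obtain \<T> where T: "finite \<T>" "card \<T> = N" "\<And>S. S \<in> \<T> \<Longrightarrow> congruent_regions S (triangle_region P Q R)"
    "pairwise (\<lambda>S S'. interior S \<inter> interior S' = {}) \<T>" "\<Union>\<T> = X"
    using assms unfolding tiled_by_def is_tiling_def by blast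
  have tile: "convex S \<and> S \<in> lmeasurable \<and> measure lebesgue S = measure lebesgue (triangle_region P Q R)"
    if S: "S \<in> \<T>" for S
  proof -
    obtain p q r where pqr: "S = convex hull {p, q, r}" "dist q r = dist Q R" "dist p r = dist P R"
      "dist p q = dist P Q"
      using congruent_region_triangle[OF T(3)[OF S]] by blast
    have "compact S"
      by (simp add: pqr(1) finite_imp_compact_convex_hull)
    then show ?thesis
      using congruent_triangle_area[OF pqr(2-4)]
      by (simp add: pqr(1) triangle_region_def lmeasurable_compact)
  qed
  have "pairwise (\<lambda>S S'. negligible (S \<inter> S')) \<T>"
    unfolding pairwise_def
  proof (intro ballI impI)
    fix S S' assume S: "S \<in> \<T>" "S' \<in> \<T>" "S \<noteq> S'"
    then have "convex (S \<inter> S')"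
      using tile by (intro convex_Int) auto
    moreover have "interior (S \<inter> S') = {}"
      using T(4) S by (simp add: pairwise_def)
    ultimately show "negligible (S \<inter> S')"
      using negligible_convex_interior by blast
  qed
  then have "measure lebesgue (\<Union>\<T>) = (\<Sum>S\<in>\<T>. measure lebesgue S)"
    using T(1) tile by (intro measure_negligible_finite_Union) auto
  also have "\<dots> = N * measure lebesgue (triangle_region P Q R)"
    using tile T(2) by simp
  finally show ?thesis using T(5) by simp
qed

lemma sum_in_Nats: "(\<And>x. x \<in> I \<Longrightarrow> f x \<in> \<nat>) \<Longrightarrow> sum f I \<in> \<nat>"
  by (induction I rule: infinite_finite_induct) auto

text \<open>The sides of the tiles along \<open>AB\<close> add up to the length of \<open>AB\<close>, because their cuts with the
  line \<open>AB\<close> cover the segment and overlap in null sets.\<close>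

lemma tiled_side_Nats:
  fixes A B C P Q R :: point
  assumes ABC: "\<not> collinear {A, B, C}" and PQR: "\<not> collinear {P, Q, R}"
    and tiled: "tiled_by N (triangle_region A B C) (triangle_region P Q R)"
    and sides: "dist Q R \<in> \<nat>" "dist P R \<in> \<nat>" "dist P Q \<in> \<nat>"
  shows "dist A B \<in> \<nat>"
proof -
  obtain \<T> where T: "finite \<T>" "\<And>S. S \<in> \<T> \<Longrightarrow> congruent_regions S (triangle_region P Q R)"
    "pairwise (\<lambda>S S'. interior S \<inter> interior S' = {}) \<T>" "\<Union>\<T> = convex hull {A, B, C}"
    using tiled unfolding tiled_by_def is_tiling_def triangle_region_def by blast
  (* n is the part of C - A orthogonal to AB, so that it points towards the triangle. *)
  define u where "u = sgn (B - A)"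
  define n where "n = (C - A) - ((C - A) \<bullet> u) *\<^sub>R u"
  have "A \<noteq> B" using ABC by auto
  then have u: "norm u = 1" "u \<noteq> 0" by (auto simp: u_def norm_sgn sgn_zero_iff)
  have nu: "n \<bullet> u = 0"
    using u(1) by (simp add: n_def inner_diff_left dot_square_norm)
  have B: "B = A + dist A B *\<^sub>R u"
    using \<open>A \<noteq> B\<close> by (simp add: u_def sgn_div_norm dist_norm norm_minus_commute)
  have "n \<noteq> 0"
  proof
    assume "n = 0"
    then have "C - A = ((C - A) \<bullet> u / dist A B) *\<^sub>R (B - A)"
      using \<open>A \<noteq> B\<close> by (subst (2) B) (simp add: n_def)
    then have "collinear {0, B - A, C - A}"
      unfolding collinear_lemma by blast
    then have "collinear {B, A, C}" by (subst collinear_3) auto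
    with ABC show False by (simp add: insert_commute)
  qed
  have nB: "n \<bullet> B = n \<bullet> A"
    by (subst B) (simp add: inner_add_right nu)
  have "n \<bullet> (C - A) = n \<bullet> n"
    using nu by (simp add: n_def inner_diff_right)
  with \<open>n \<noteq> 0\<close> have nC: "n \<bullet> C > n \<bullet> A"
    by (simp add: inner_diff_right flip: inner_gt_zero_iff)
  have above: "n \<bullet> x \<ge> n \<bullet> A" if "x \<in> convex hull {A, B, C}" for x
  proof -
    have "convex hull {A, B, C} \<subseteq> {x. n \<bullet> x \<ge> n \<bullet> A}"
      using nB nC by (intro hull_minimal) (auto simp: convex_halfspace_ge)
    with that show ?thesis by blast
  qed
  have tile: "convex S \<and> trace A u S \<in> lmeasurable \<and> measure lebesgue (trace A u S) \<in> \<nat>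
      \<and> (\<exists>r\<in>S. n \<bullet> r > n \<bullet> A)" if S: "S \<in> \<T>" for S
  proof -
    obtain p q r where pqr: "S = convex hull {p, q, r}" "dist q r = dist Q R" "dist p r = dist P R"
      "dist p q = dist P Q"
      using congruent_region_triangle[OF T(2)[OF S]] by blast
    have nc: "\<not> collinear {p, q, r}"
      using PQR congruent_triangle_area[OF pqr(2-4)] by (simp add: collinear_iff_area_eq_0)
    have mem: "p \<in> S" "q \<in> S" "r \<in> S"
      by (auto simp: pqr(1) hull_inc)
    then have ge: "n \<bullet> p \<ge> n \<bullet> A" "n \<bullet> q \<ge> n \<bullet> A" "n \<bullet> r \<ge> n \<bullet> A"
      using above T(4) S by blast+
    have "measure lebesgue (trace A u S) \<in> {0, dist q r, dist p r, dist p q}"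
      unfolding pqr(1) using measure_trace_triangle[OF u(1) \<open>n \<noteq> 0\<close> nu nc ge] .
    then have "measure lebesgue (trace A u S) \<in> \<nat>"
      using sides pqr(2-4) by auto
    moreover have "\<exists>r\<in>S. n \<bullet> r > n \<bullet> A"
      using collinear_level_line[OF \<open>n \<noteq> 0\<close>, of p "n \<bullet> A" q r] nc ge mem by force
    ultimately show ?thesis
      using lmeasurable_trace_triangle[OF u(2)] by (simp add: pqr(1))
  qed
  have "dist A B = measure lebesgue (trace A u (convex hull {A, B, C}))"
    using measure_trace_edge[OF u(1) \<open>n \<noteq> 0\<close> nu nC _ nB] by simp
  also have "trace A u (convex hull {A, B, C}) = \<Union> (trace A u ` \<T>)"
    by (auto simp: trace_def simp flip: T(4))
  also have "measure lebesgue \<dots> = (\<Sum>S\<in>\<T>. measure lebesgue (trace A u S))"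
  proof (rule measure_negligible_finite_Union_image)
    show "pairwise (\<lambda>S S'. negligible (trace A u S \<inter> trace A u S')) \<T>"
      unfolding pairwise_def
    proof (intro ballI impI)
      fix S S' assume S: "S \<in> \<T>" "S' \<in> \<T>" "S \<noteq> S'"
      then obtain r r' where "r \<in> S" "n \<bullet> r > n \<bullet> A" "r' \<in> S'" "n \<bullet> r' > n \<bullet> A"
        using tile by meson
      moreover have "interior S \<inter> interior S' = {}"
        using T(3) S unfolding pairwise_def by blast
      ultimately show "negligible (trace A u S \<inter> trace A u S')"
        using negligible_trace_Int tile S u(2) nu by blast
    qed
  qed (use T(1) tile in auto)
  also have "\<dots> \<in> \<nat>"
    using tile by (intro sum_in_Nats) auto
  finally show ?thesis .
qed

section \<open>The arithmetic of the tile\<close>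

lemma squarefree_part_eq_if_square_mult:
  fixes m n :: nat
  assumes "is_nth_power 2 (m * n)" "m > 0" "n > 0"
  shows "squarefree_part m = squarefree_part n"
proof (rule multiplicity_eq_imp_eq[where 'a = nat, simplified])
  fix p :: nat assume p: "prime p"
  have "even (multiplicity p (m * n))"
    using assms p by (simp add: is_nth_power_conv_multiplicity_nat)
  then have "even (multiplicity p m + multiplicity p n)"
    using p assms by (simp add: prime_elem_multiplicity_mult_distrib)
  then show "multiplicity p (squarefree_part m) = multiplicity p (squarefree_part n)"
    using p by (simp add: prime_multiplicity_squarefree_part) presburger
qed (auto intro: gr0I)

lemma squarefree_part_squarefree:
  fixes n :: nat
  assumes "squarefree n"
  shows "squarefree_part n = n"
proof -
  have "square_part n dvd 1"
    using assms square_part_square_dvd by (rule squarefreeD)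
  then show ?thesis
    by (metis mult.right_neutral nat_dvd_1_iff_1 power_one squarefree_decompose)
qed

text \<open>A prime dividing both \<open>a\<close> and \<open>b\<close> would divide \<open>c\<close> as well. So \<open>a\<close> and \<open>a + b\<close> are coprime
  factors of a square.\<close>

lemma square_if_mult_add_square:
  fixes a b c :: nat
  assumes "c\<^sup>2 = a * (a + b)" "gcd a (gcd b c) = 1" "a > 0"
  shows "is_nth_power 2 a"
proof -
  have "coprime a b"
  proof (rule ccontr)
    assume "\<not> coprime a b"
    then have "gcd a b \<noteq> 1" by (simp add: coprime_iff_gcd_eq_1)
    then obtain p where p: "prime p" "p dvd a" "p dvd b"
      using prime_factor_nat[of "gcd a b"] by auto
    then have "p dvd c\<^sup>2" by (simp add: assms(1))
    then have "p dvd c" using p(1) prime_dvd_power by blast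
    with p have "p dvd gcd a (gcd b c)" by simp
    with assms(2) p(1) show False by (metis not_prime_unit)
  qed
  then have "coprime a (a + b)"
    by (simp add: coprime_iff_gcd_eq_1)
  then show ?thesis
    using is_nth_power_mult_coprime_natD(1)[of a "a + b" 2] assms(1,3)
    by (metis is_nth_power_nth_power add_gr_0)
qed

text \<open>The first equation is the law of sines, obtained by computing the area at two vertices.
  Substituting it into the law of cosines at \<open>P\<close> gives the second equation multiplied by the
  difference of \<open>QR\<close> and \<open>PR\<close>. When these are equal, the law of cosines at \<open>R\<close> shows that the
  triangle is right-angled, and the second equation is the theorem of Pythagoras.\<close>

lemma double_angle_triangle_sides:
  fixes P Q R :: point
  assumes "\<not> collinear {P, Q, R}" "angle P R Q = 2 * angle Q P R"
  shows "dist P Q = 2 * dist Q R * cos (angle Q P R)"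
    and "(dist P Q)\<^sup>2 = dist Q R * (dist Q R + dist P R)"
proof -
  define a b c \<alpha> where [simp]: "a = dist Q R" "b = dist P R" "c = dist P Q" "\<alpha> = angle Q P R"
  have pos: "a > 0" "b > 0" "c > 0" using noncollinear_distinct[OF assms(1)] by auto
  have sin: "sin \<alpha> > 0"
    using assms(1) sin_angle_pos[of Q P R] by (simp add: insert_commute)
  have "measure lebesgue (convex hull {Q, P, R}) = measure lebesgue (convex hull {P, R, Q})"
    by (simp add: insert_commute)
  then have "c * b * sin \<alpha> = b * a * sin (2 * \<alpha>)"
    using assms(2) by (simp add: area_triangle_sin dist_commute)
  then show c: "dist P Q = 2 * dist Q R * cos (angle Q P R)"
    using pos sin by (simp add: sin_double)
  have eq_P: "a\<^sup>2 = c\<^sup>2 + b\<^sup>2 - 2 * c * b * cos \<alpha>"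
    using law_of_cosines[of Q R P] by (simp add: dist_commute)
  have eq_R: "c\<^sup>2 = b\<^sup>2 + a\<^sup>2 - 2 * b * a * cos (2 * \<alpha>)"
    using law_of_cosines[of P Q R] assms(2) by (simp add: dist_commute)
  have "(a - b) * (c\<^sup>2 - a * (a + b)) = 0"
  proof -
    have "c = 2 * a * cos \<alpha>" using c by simp
    with eq_P have "a * a\<^sup>2 = a * c\<^sup>2 + a * b\<^sup>2 - c * b * c" by algebra
    then show ?thesis by algebra
  qed
  then show "(dist P Q)\<^sup>2 = dist Q R * (dist Q R + dist P R)"
  proof (cases "a = b")
    case True
    have "c\<^sup>2 = 4 * a\<^sup>2 - (2 * a * cos \<alpha>)\<^sup>2"
      using eq_R unfolding True cos_double_cos by algebra
    then have "c\<^sup>2 = 2 * a\<^sup>2"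
      using c by simp
    then show ?thesis using True by (simp add: power2_eq_square)
  qed auto
qed

text \<open>By the law of cosines the base of an isosceles triangle is twice the projection of a leg.\<close>

lemma isosceles_area:
  assumes "\<not> collinear {A, B, C}" "dist A B = dist A C" 
  shows "measure lebesgue (convex hull {A, B, C})
    = (dist A B)\<^sup>2 * cos (angle A B C) * sin (angle A B C)"
proof -
  have "dist B C > 0" using assms(1) by auto
  moreover have "(dist B C)\<^sup>2 = 2 * dist A B * dist B C * cos (angle A B C)"
    using law_of_cosines[of A C B] assms(2) by (simp add: dist_commute)
  ultimately have "dist C B = 2 * dist A B * cos (angle A B C)"
    by (simp add: power2_eq_square dist_commute)
  then show ?thesis
    unfolding area_triangle_sin by (simp only:) (simp add: power2_eq_square)
qed

theorem lemma11p6: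
  fixes A B C P Q R :: point
    and \<alpha> \<beta> \<gamma> :: real
    and a b c N :: nat
  assumes "isosceles_with_apex A B C"
    and "has_base_angles A B C \<alpha>"
    and "\<not> (\<exists>q\<in>\<rat>. \<alpha> = q * pi)"
    and "nondegenerate_triangle P Q R"
    and "has_angles P Q R \<alpha> \<beta> \<gamma>"
    and "\<gamma> = 2 * \<alpha>"
    and "has_sides P Q R (real a) (real b) (real c)"
    and "gcd a (gcd b c) = 1"
    and "tiled_by N (triangle_region A B C) (triangle_region P Q R)"
  shows "squarefree_part N dvd b \<and> squarefree_part b dvd N \<and>
         (squarefree N \<longrightarrow>
            N dvd b \<and> is_nth_power 2 (b div N) \<and> (\<exists>l::int. int b = int N * l\<^sup>2))"
proof -
  have ABC: "\<not> collinear {A, B, C}" and leg: "dist A B = dist A C" and \<alpha>: "angle A B C = \<alpha>"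
    using assms(1,2)
    by (auto simp: isosceles_with_apex_def nondegenerate_triangle_def has_base_angles_def)
  have PQR: "\<not> collinear {P, Q, R}" and sides: "dist Q R = a" "dist P R = b" "dist P Q = c"
    and ang: "angle Q P R = \<alpha>" "angle P R Q = 2 * \<alpha>"
    using assms(4-7) by (auto simp: nondegenerate_triangle_def has_sides_def has_angles_def)
  have pos: "a > 0" "b > 0" "dist A B > 0"
    using noncollinear_distinct[OF PQR] noncollinear_distinct[OF ABC] sides
    by (auto intro!: gr0I)
  have sin: "sin \<alpha> > 0"
    using sin_angle_pos[OF ABC] \<alpha> by simp
  have c: "real c = 2 * a * cos \<alpha>" and "(real c)\<^sup>2 = a * (a + b)"
    using double_angle_triangle_sides[OF PQR] ang sides by simp_all
  then have "c\<^sup>2 = a * (a + b)"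
    by (metis of_nat_add of_nat_eq_iff of_nat_mult of_nat_power)
  then have a: "is_nth_power 2 a"
    using assms(8) pos(1) by (rule square_if_mult_add_square)
  obtain X where X: "dist A B = real X"
    using tiled_side_Nats[OF ABC PQR assms(9)] sides by (auto elim: Nats_cases)
  have "(real X)\<^sup>2 * cos \<alpha> * sin \<alpha> = N * (c * b * sin \<alpha> / 2)"
    using tiled_area[OF assms(9)] isosceles_area[OF ABC leg] area_triangle_sin[of Q P R]
    by (simp add: triangle_region_def X \<alpha> ang sides dist_commute insert_commute)
  then have "(real X)\<^sup>2 * cos \<alpha> = N * (a * cos \<alpha> * b)"
    using sin by (simp add: c)
  moreover have "cos \<alpha> \<noteq> 0"
    using c PQR sides by auto
  ultimately have "(real X)\<^sup>2 = N * b * a" by simp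
  then have XN: "X\<^sup>2 = N * b * a"
    by (metis of_nat_eq_iff of_nat_mult of_nat_power)
  then have "is_nth_power 2 (N * b * a)"
    by (metis is_nth_power_nth_power)
  then have Nb: "is_nth_power 2 (N * b)"
    using a pos(1) is_nth_power_mult_cancel_right[of 2 a "N * b"] by auto
  have "N > 0"
    using XN X pos(3) by (intro gr0I) auto
  with Nb pos have eq: "squarefree_part N = squarefree_part b"
    by (intro squarefree_part_eq_if_square_mult) auto
  have "squarefree_part N dvd N" "squarefree_part b dvd b"
    by (metis dvd_triv_left squarefree_decompose)+
  with eq have dvd: "squarefree_part N dvd b" "squarefree_part b dvd N" by auto
  have "N dvd b \<and> is_nth_power 2 (b div N) \<and> (\<exists>l::int. int b = int N * l\<^sup>2)" if "squarefree N"
  proof -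
    have b: "b = N * (square_part b)\<^sup>2"
      using squarefree_decompose[of b] squarefree_part_squarefree[OF that] eq by metis
    then have "b div N = (square_part b)\<^sup>2"
      using \<open>N > 0\<close> by (metis nonzero_mult_div_cancel_left less_numeral_extra(3))
    then show ?thesis
      using b by (metis dvd_triv_left is_nth_power_nth_power of_nat_mult of_nat_power)
  qed
  with dvd show ?thesis by blast
qed

end
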